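(* Let $k\geq 2$. There is no $k$-geodetic digraph with minimum out-degree at least $2$ and order $M(2,k)+2$ (where $M(2,k)=1+2+\dots+2^k$) whose in-degree sequence is $(1,1,1,1,2,\dots,2,3,3,3,3)$, i.e. exactly four vertices have in-degree $1$, exactly four have in-degree $3$, and all others have in-degree $2$.
   Context: A digraph is $k$-geodetic if for any two vertices $u,v$ there is at most one directed walk from $u$ to $v$ of length at most $k$. The in-degree sequence is the list of in-degrees in non-decreasing order. *)

theory Defs
  imports "Graph_Theory.Arc_Walk" "HOL-Library.Multiset"
begin

definition k_geodetic :: "nat \<Rightarrow> ('a, 'b) pre_digraph \<Rightarrow> bool" where
  "k_geodetic k G \<longleftrightarrow>
     (\<forall>u \<in> verts G. \<forall>v \<in> verts G. \<forall>p q.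
        pre_digraph.awalk G u p v \<and> length p \<le> k \<and>
        pre_digraph.awalk G u q v \<and> length q \<le> k \<longrightarrow> p = q)"

definition min_out_degree :: "('a, 'b) pre_digraph \<Rightarrow> nat" where
  "min_out_degree G = Min (out_degree G ` verts G)"

definition in_degree_sequence :: "('a, 'b) pre_digraph \<Rightarrow> nat list" where
  "in_degree_sequence G =
     sorted_list_of_multiset (image_mset (in_degree G) (mset_set (verts G)))"

definition moore_bound :: "nat \<Rightarrow> nat \<Rightarrow> nat" where
  "moore_bound d k = (\<Sum>i\<le>k. d ^ i)"

text \<open>
  A loop gives walks of length 0 and 1 between the same vertices, and parallel arcs give two
  walks of length 1. So a finite geodetic digraph has neither, and the locale \<^locale>\<open>digraph\<close>
  imposes no restriction beyond finiteness.
\<close>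

lemma k_geodetic_imp_digraph:
  assumes wf: "fin_digraph G" and geo: "k_geodetic k G" and k: "1 \<le> k"
  shows "digraph G"
proof -
  interpret fin_digraph G by (rule wf)
  have uniq: "p = q"
    if "awalk u p v" "length p \<le> k" "awalk u q v" "length q \<le> k" for u v p q
    using geo that awlast_in_verts awalk_conv unfolding k_geodetic_def
    by (metis awalk_def)
  have "tail G e \<noteq> head G e" if "e \<in> arcs G" for e
    using uniq[of "tail G e" "[]" "head G e" "[e]"] that k by (auto simp: awalk_def)
  moreover have "e1 = e2"
    if "e1 \<in> arcs G" "e2 \<in> arcs G" "arc_to_ends G e1 = arc_to_ends G e2" for e1 e2
    using uniq[of "tail G e1" "[e1]" "head G e1" "[e2]"] that k
    by (auto simp: awalk_def arc_to_ends_def)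
  ultimately show ?thesis by unfold_locales
qed

end

theory Submission
  imports Defs "Jordan_Normal_Form.Schur_Decomposition"
begin

text \<open>
  Let \<open>A\<close> be the adjacency matrix, \<open>J\<close> the all-ones matrix, \<open>M = I + A + \<dots> + A ^ k\<close> and \<open>S\<close> the set of
  the four vertices of in-degree 1.  All out-degrees are 2 and \<open>M\<close> is a 0-1 matrix.  Counting gives
  \<open>A (J - M) = 1 * 1\<^sub>S\<^sup>T\<close>, hence \<open>A ^ (k + 2) - A = (A ^ 2 - A) M = 1 * w\<^sup>T\<close> with \<open>w = 2 - 1\<^sub>S > 0\<close>.
  So every eigenvalue \<open>l\<close> of \<open>A\<close> is 2, 0 or a root of unity with \<open>l ^ (k + 1) = 1\<close>; in the last two
  cases \<open>l ^ k\<close> is the conjugate of \<open>l\<close>.  Since \<open>A\<close> and \<open>A ^ k\<close> have trace 0, the multiplicity \<open>m\<close> of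
  2 satisfies \<open>m * (2 ^ k - 2) = 0\<close>, so 2 is not an eigenvalue.  Then \<open>A ^ (k + 2)\<close> and \<open>A\<close> have
  equal traces, which contradicts \<open>w > 0\<close>.
\<close>

section \<open>Triangular matrices and traces of powers\<close>

lemma diag_mult_upper_triangular:
  fixes A B :: "'a :: comm_ring_1 mat"
  assumes A: "A \<in> carrier_mat n n" "upper_triangular A"
    and B: "B \<in> carrier_mat n n" "upper_triangular B" and i: "i < n"
  shows "(A * B) $$ (i, i) = A $$ (i, i) * B $$ (i, i)"
proof -
  have "(A * B) $$ (i, i) = (\<Sum>l<n. A $$ (i, l) * B $$ (l, i))"
    using A B i by (simp add: scalar_prod_def atLeast0LessThan)
  also have "\<dots> = (\<Sum>l<n. if l = i then A $$ (i, i) * B $$ (i, i) else 0)"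
  proof (rule sum.cong)
    fix l assume "l \<in> {..<n}"
    then show "A $$ (i, l) * B $$ (l, i) = (if l = i then A $$ (i, i) * B $$ (i, i) else 0)"
      using A B i by (cases l i rule: linorder_cases) (auto simp: upper_triangular_def)
  qed simp
  finally show ?thesis using i by simp
qed

lemma upper_triangular_mult:
  fixes A B :: "'a :: comm_ring_1 mat"
  assumes A: "A \<in> carrier_mat n n" "upper_triangular A"
    and B: "B \<in> carrier_mat n n" "upper_triangular B"
  shows "upper_triangular (A * B)"
proof (rule upper_triangularI)
  fix i j assume ij: "j < i" "i < dim_row (A * B)"
  have "(A * B) $$ (i, j) = (\<Sum>l<n. A $$ (i, l) * B $$ (l, j))"
    using A B ij by (simp add: scalar_prod_def atLeast0LessThan)
  also have "\<dots> = 0"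
  proof (rule sum.neutral, rule ballI)
    fix l assume "l \<in> {..<n}"
    then show "A $$ (i, l) * B $$ (l, j) = 0"
      using A B ij by (cases "l < i") (auto simp: upper_triangular_def)
  qed
  finally show "(A * B) $$ (i, j) = 0" .
qed

lemma upper_triangular_pow:
  fixes A :: "'a :: comm_ring_1 mat"
  assumes A: "A \<in> carrier_mat n n" "upper_triangular A"
  shows "upper_triangular (A ^\<^sub>m j) \<and> (\<forall>i<n. (A ^\<^sub>m j) $$ (i, i) = (A $$ (i, i)) ^ j)"
proof (induction j)
  case 0
  then show ?case using A by simp
next
  case (Suc j)
  have "A ^\<^sub>m j \<in> carrier_mat n n" using A by simp
  then show ?case
    using Suc A upper_triangular_mult[of "A ^\<^sub>m j" n A]
      diag_mult_upper_triangular[of "A ^\<^sub>m j" n A] by (simp add: mult.commute)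
qed

lemma trace_mult_commute:
  fixes A B :: "'a :: comm_ring_1 mat"
  assumes A: "A \<in> carrier_mat n n" and B: "B \<in> carrier_mat n n"
  shows "(\<Sum>i<n. (A * B) $$ (i, i)) = (\<Sum>i<n. (B * A) $$ (i, i))"
proof -
  have "(\<Sum>i<n. (A * B) $$ (i, i)) = (\<Sum>i<n. \<Sum>l<n. A $$ (i, l) * B $$ (l, i))"
    using A B by (simp add: scalar_prod_def atLeast0LessThan)
  also have "\<dots> = (\<Sum>l<n. \<Sum>i<n. B $$ (l, i) * A $$ (i, l))"
    by (subst sum.swap) (simp add: mult.commute)
  also have "\<dots> = (\<Sum>i<n. (B * A) $$ (i, i))"
    using A B by (simp add: scalar_prod_def atLeast0LessThan)
  finally show ?thesis .
qed

text \<open>Triangularise \<open>A\<close> as \<open>P * B * Q\<close> with \<open>Q\<close> inverse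
  to \<open>P\<close>. The diagonal of \<open>B\<close> lists the eigenvalues with algebraic
  multiplicity, and the trace of \<open>A ^\<^sub>m j\<close> is that of
  \<open>B ^\<^sub>m j\<close>. The same list \<open>ev\<close> serves every exponent.\<close>

lemma trace_pow_eq_power_sum:
  fixes A :: "complex mat"
  assumes A: "A \<in> carrier_mat n n"
  obtains ev where "\<And>i. i < n \<Longrightarrow> eigenvalue A (ev i)"
    and "\<And>j. (\<Sum>i<n. (A ^\<^sub>m j) $$ (i, i)) = (\<Sum>i<n. ev i ^ j)"
proof -
  obtain as where "char_poly A = (\<Prod>a\<leftarrow>as. [:- a, 1:])"
    using char_poly_factorized[OF A] by blast
  then obtain B where B: "B \<in> carrier_mat n n" "upper_triangular B" and AB: "similar_mat A B"
    using schur_decomposition_exists[OF A] by blast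
  obtain P Q where wit: "similar_mat_wit A B P Q"
    using AB unfolding similar_mat_def by blast
  note PQ = similar_mat_witD2[OF A wit]
  show thesis
  proof (rule that[of "\<lambda>i. B $$ (i, i)"])
    fix i assume i: "i < n"
    have "char_poly A = (\<Prod>a\<leftarrow>diag_mat B. [:- a, 1:])"
      using char_poly_similar[OF AB] char_poly_upper_triangular[OF B] by simp
    moreover have "B $$ (i, i) \<in> set (diag_mat B)"
      using i B by (auto simp: diag_mat_def)
    ultimately have "poly (char_poly A) (B $$ (i, i)) = 0"
      by (auto simp: poly_prod_list prod_list_zero_iff)
    then show "eigenvalue A (B $$ (i, i))"
      by (simp add: eigenvalue_root_char_poly[OF A])
  next
    fix j
    have Bj: "B ^\<^sub>m j \<in> carrier_mat n n" using B by simp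
    have "(\<Sum>i<n. (A ^\<^sub>m j) $$ (i, i)) = (\<Sum>i<n. (P * (B ^\<^sub>m j * Q)) $$ (i, i))"
      using similar_mat_wit_pow_id[OF wit, of j] PQ Bj by (simp add: assoc_mult_mat[of _ n n _ n _ n])
    also have "\<dots> = (\<Sum>i<n. ((B ^\<^sub>m j * Q) * P) $$ (i, i))"
      by (rule trace_mult_commute) (use PQ Bj in auto)
    also have "(B ^\<^sub>m j * Q) * P = B ^\<^sub>m j"
      using PQ Bj by (simp add: assoc_mult_mat[of _ n n _ n _ n])
    also have "(\<Sum>i<n. (B ^\<^sub>m j) $$ (i, i)) = (\<Sum>i<n. (B $$ (i, i)) ^ j)"
      using upper_triangular_pow[OF B] by simp
    finally show "(\<Sum>i<n. (A ^\<^sub>m j) $$ (i, i)) = (\<Sum>i<n. (B $$ (i, i)) ^ j)" .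
  qed
qed

section \<open>Spectrum of a matrix with constant row sums and a rank one relation\<close>

text \<open>All rows of \<open>A ^\<^sub>m m - A\<close> agree, so this matrix maps an eigenvector
  \<open>v\<close> to a constant vector, which is also \<open>l ^ m - l\<close> times
  \<open>v\<close>. Unless that factor vanishes, \<open>v\<close> itself is constant and its
  eigenvalue is the row sum.\<close>

lemma eigenvalue_cases_rank_one:
  fixes A :: "complex mat"
  assumes A: "A \<in> carrier_mat n n"
    and row: "\<And>i. i < n \<Longrightarrow> (\<Sum>j<n. A $$ (i, j)) = d"
    and rank1: "\<And>i j. i < n \<Longrightarrow> j < n \<Longrightarrow> (A ^\<^sub>m m) $$ (i, j) - A $$ (i, j) = w j"
    and ev: "eigenvalue A l"
  shows "l = d \<or> l ^ m = l"
proof (rule disjCI)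
  assume ne: "l ^ m \<noteq> l"
  obtain v where v: "eigenvector A v l" using ev unfolding eigenvalue_def by blast
  then have vc: "v \<in> carrier_vec n" and v0: "v \<noteq> 0\<^sub>v n" and Av: "A *\<^sub>v v = l \<cdot>\<^sub>v v"
    using A unfolding eigenvector_def by auto
  have mult: "(B *\<^sub>v v) $ i = (\<Sum>j<n. B $$ (i, j) * v $ j)"
    if "B \<in> carrier_mat n n" "i < n" for B i
    using that vc by (simp add: scalar_prod_def atLeast0LessThan)
  define c where "c = (\<Sum>j<n. w j * v $ j) / (l ^ m - l)"
  have vi: "v $ i = c" if i: "i < n" for i
  proof -
    have "(l ^ m - l) * v $ i = (A ^\<^sub>m m *\<^sub>v v) $ i - (A *\<^sub>v v) $ i"
      using i vc by (simp add: eigenvector_pow[OF A v] Av algebra_simps)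
    also have "\<dots> = (\<Sum>j<n. ((A ^\<^sub>m m) $$ (i, j) - A $$ (i, j)) * v $ j)"
      using mult[OF A i] mult[OF pow_carrier_mat[OF A] i]
      by (simp only: left_diff_distrib sum_subtractf)
    also have "\<dots> = (\<Sum>j<n. w j * v $ j)"
      using rank1[OF i] by simp
    finally show ?thesis using ne by (simp add: c_def field_simps)
  qed
  \<comment> \<open>A nonzero coordinate shows \<open>c\<close> to be nonzero, so that
    \<open>c\<close> can be cancelled from \<open>l * c = d * c\<close>.\<close>
  obtain i where i: "i < n" "v $ i \<noteq> 0"
    using v0 vc by (metis carrier_vecD eq_vecI index_zero_vec(1,2))
  have "l * c = (A *\<^sub>v v) $ i" using i vc vi by (simp add: Av)
  also have "\<dots> = (\<Sum>j<n. A $$ (i, j) * c)" using mult[OF A i(1)] vi by simp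
  also have "\<dots> = d * c" using row[OF i(1)] by (simp flip: sum_distrib_right)
  finally show "l = d" using i vi by auto
qed

lemma no_eigenvalue_two:
  fixes ev :: "nat \<Rightarrow> complex"
  assumes k: "2 \<le> k"
    and cases: "\<And>i. i < n \<Longrightarrow> ev i = 2 \<or> ev i ^ (k + 2) = ev i"
    and tr1: "(\<Sum>i<n. ev i) = 0" and trk: "(\<Sum>i<n. ev i ^ k) = 0" and i: "i < n"
  shows "ev i \<noteq> 2"
proof -
  \<comment> \<open>A nonzero \<open>l\<close> lies on the unit circle, where \<open>l ^ k\<close>
    and \<open>cnj l\<close> are both its inverse; for \<open>l = 0\<close> positivity of
    \<open>k\<close> suffices.\<close>
  have pow: "l ^ k = cnj l" if "l ^ (k + 2) = l" for l :: complex
  proof (cases "l = 0")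
    case False
    have "l * l ^ (k + 1) = l * 1" using that by (simp add: algebra_simps)
    then have l1: "l ^ (k + 1) = 1" using False by (simp only: mult_cancel_left) simp
    then have "norm l ^ (k + 1) = 1" by (metis norm_one norm_power)
    then have "norm l = 1" using power_eq_1_iff[of "norm l" "k + 1"] by simp
    then have "l * cnj l = 1" by (simp add: complex_norm_square[symmetric])
    moreover have "l * l ^ k = 1" using l1 by simp
    ultimately show ?thesis using False by (metis mult_cancel_left)
  qed (use k in simp)
  define N where "N = card {i \<in> {..<n}. ev i = 2}"
  \<comment> \<open>The correction is \<open>2 ^ k - cnj 2\<close>, incurred once for each index
    counted by \<open>N\<close>.\<close>
  have "(\<Sum>i<n. ev i ^ k) = (\<Sum>i<n. cnj (ev i) + (if ev i = 2 then 2 ^ k - 2 else 0))"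
    by (rule sum.cong) (use cases pow in auto)
  also have "\<dots> = cnj (\<Sum>i<n. ev i) + (\<Sum>i<n. (if ev i = 2 then 2 ^ k - 2 else 0))"
    by (simp add: sum.distrib)
  also have "(\<Sum>i<n. (if ev i = 2 then 2 ^ k - 2 else 0)) = of_nat N * (2 ^ k - 2 :: complex)"
    unfolding N_def by (subst sum.inter_filter[symmetric]) auto
  finally have "of_nat N * (2 ^ k - 2 :: complex) = 0" using tr1 trk by simp
  moreover have "(2 ^ k - 2 :: complex) \<noteq> 0"
  proof
    assume "(2 ^ k - 2 :: complex) = 0"
    then have "of_nat (2 ^ k) = (of_nat 2 :: complex)" by simp
    then have "(2::nat) ^ k = 2 ^ 1" unfolding of_nat_eq_iff by simp
    then have "k = 1" by (subst (asm) power_inject_exp) auto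
    then show False using k by simp
  qed
  ultimately have "N = 0" by simp
  then show ?thesis using i unfolding N_def by auto
qed

text \<open>Once 2 is excluded, every eigenvalue satisfies \<open>l ^ (k + 2) = l\<close>, so
  \<open>A ^\<^sub>m (k + 2)\<close> and \<open>A\<close> have equal traces. The difference of these
  traces is the sum of \<open>w\<close>.\<close>

lemma no_rank_one_perturbation:
  fixes A :: "complex mat"
  assumes A: "A \<in> carrier_mat n n" and k: "2 \<le> k"
    and row: "\<And>i. i < n \<Longrightarrow> (\<Sum>j<n. A $$ (i, j)) = 2"
    and rank1: "\<And>i j. i < n \<Longrightarrow> j < n \<Longrightarrow> (A ^\<^sub>m (k + 2)) $$ (i, j) - A $$ (i, j) = w j"
    and tr1: "(\<Sum>i<n. A $$ (i, i)) = 0" and trk: "(\<Sum>i<n. (A ^\<^sub>m k) $$ (i, i)) = 0"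
  shows "(\<Sum>i<n. w i) = 0"
proof -
  obtain ev where ev: "\<And>i. i < n \<Longrightarrow> eigenvalue A (ev i)"
    and tr: "\<And>j. (\<Sum>i<n. (A ^\<^sub>m j) $$ (i, i)) = (\<Sum>i<n. ev i ^ j)"
    using trace_pow_eq_power_sum[OF A] by metis
  have cases: "ev i = 2 \<or> ev i ^ (k + 2) = ev i" if "i < n" for i
    using eigenvalue_cases_rank_one[OF A row rank1 ev[OF that]] by blast
  have "A ^\<^sub>m 1 = A" using A by simp
  then have s1: "(\<Sum>i<n. ev i) = 0" using tr[of 1] tr1 by simp
  have sk: "(\<Sum>i<n. ev i ^ k) = 0" using tr[of k] trk by simp
  have "ev i ^ (k + 2) = ev i" if "i < n" for i
    using cases[OF that] no_eigenvalue_two[OF k cases s1 sk that] by blast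
  then have "(\<Sum>i<n. ev i ^ (k + 2)) = (\<Sum>i<n. ev i)" by (intro sum.cong) auto
  then have "(\<Sum>i<n. (A ^\<^sub>m (k + 2)) $$ (i, i)) = 0" unfolding tr s1 .
  moreover have "(\<Sum>i<n. w i) = (\<Sum>i<n. (A ^\<^sub>m (k + 2)) $$ (i, i) - A $$ (i, i))"
    by (intro sum.cong refl rank1[symmetric]) auto
  ultimately show ?thesis using tr1 by (simp add: sum_subtractf)
qed

section \<open>Walk counts forced by the order and the degrees\<close>

text \<open>
  \<open>W j u v\<close> stands for the entry \<open>(u, v)\<close> of \<open>A ^ j\<close>.  The rows of \<open>A (J - M)\<close> sum to \<open>4 = |S|\<close>, and its
  entries in the columns of \<open>S\<close> are at least 1 because \<open>A M = M A\<close>; below, \<open>T\<close> is \<open>A M\<close>.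
\<close>

lemma walk_count_rank_one:
  fixes W :: "nat \<Rightarrow> 'a \<Rightarrow> 'a \<Rightarrow> int"
  assumes V: "finite V" "card V = moore_bound 2 k + 2"
    and W0: "\<And>u v. u \<in> V \<Longrightarrow> W 0 u v = (if u = v then 1 else 0)"
    and add: "\<And>i j u v. u \<in> V \<Longrightarrow> v \<in> V \<Longrightarrow> W (i + j) u v = (\<Sum>x\<in>V. W i u x * W j x v)"
    and nonneg: "\<And>j u v. 0 \<le> W j u v"
    and row: "\<And>u. u \<in> V \<Longrightarrow> (\<Sum>v\<in>V. W 1 u v) = 2"
    and le1: "\<And>u v. u \<in> V \<Longrightarrow> v \<in> V \<Longrightarrow> (\<Sum>j\<le>k. W j u v) \<le> 1"
    and S: "S \<subseteq> V" "card S = 4" "\<And>v. v \<in> S \<Longrightarrow> (\<Sum>u\<in>V. W 1 u v) = 1"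
    and uv: "u \<in> V" "v \<in> V"
  shows "W (k + 2) u v - W 1 u v = 2 - (if v \<in> S then 1 else 0)"
proof -
  define M where "M u v = (\<Sum>j\<le>k. W j u v)" for u v
  define T where "T u v = (\<Sum>j\<le>k. W (Suc j) u v)" for u v
  have T1: "T u v = (\<Sum>x\<in>V. W 1 u x * M x v)" if "u \<in> V" "v \<in> V" for u v
    unfolding T_def M_def sum_distrib_left
    by (subst sum.swap) (use add[OF that, of 1] in simp)
  have T2: "T u v = (\<Sum>x\<in>V. M u x * W 1 x v)" if "u \<in> V" "v \<in> V" for u v
    unfolding T_def M_def sum_distrib_right
    by (subst sum.swap) (use add[OF that, of _ 1] in simp)
  have rowj: "(\<Sum>v\<in>V. W j u v) = 2 ^ j" if "u \<in> V" for j u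
    using that
  proof (induction j arbitrary: u)
    case 0
    then show ?case using V by (simp add: W0)
  next
    case (Suc j)
    have "(\<Sum>v\<in>V. W (Suc j) u v) = (\<Sum>v\<in>V. \<Sum>x\<in>V. W 1 u x * W j x v)"
      using add[OF Suc.prems, of _ 1 j] by simp
    also have "\<dots> = (\<Sum>x\<in>V. W 1 u x * (\<Sum>v\<in>V. W j x v))"
      by (subst sum.swap) (simp add: sum_distrib_left)
    also have "\<dots> = (\<Sum>x\<in>V. W 1 u x * 2 ^ j)" using Suc.IH by simp
    also have "\<dots> = 2 ^ Suc j" using row[OF Suc.prems] by (simp flip: sum_distrib_right)
    finally show ?case .
  qed
  have rowM: "(\<Sum>v\<in>V. M u v) = int (moore_bound 2 k)" if "u \<in> V" for u
    unfolding M_def by (subst sum.swap) (simp add: rowj that moore_bound_def)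
  \<comment> \<open>Reading \<open>T\<close> as \<open>A M\<close> bounds it by the row sums of
    \<open>A\<close>; reading it as \<open>M A\<close> bounds it by the column sums, which are 1 on
    \<open>S\<close>.\<close>
  have T_le2: "T u v \<le> 2" if "u \<in> V" "v \<in> V" for u v
  proof -
    have "T u v \<le> (\<Sum>x\<in>V. W 1 u x * 1)"
      unfolding T1[OF that] by (intro sum_mono mult_left_mono nonneg) (use le1 that M_def in auto)
    then show ?thesis using row that by simp
  qed
  have T_le1: "T u v \<le> 1" if "u \<in> V" "v \<in> S" for u v
  proof -
    have vV: "v \<in> V" using S that by blast
    have "T u v \<le> (\<Sum>x\<in>V. 1 * W 1 x v)"
      unfolding T2[OF that(1) vV] by (intro sum_mono mult_right_mono nonneg) (use le1 that M_def in auto)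
    then show ?thesis using S that by simp
  qed
  have rowT: "(\<Sum>v\<in>V. T u v) = 2 * int (moore_bound 2 k)" if "u \<in> V" for u
  proof -
    have "(\<Sum>v\<in>V. T u v) = (\<Sum>x\<in>V. W 1 u x * (\<Sum>v\<in>V. M x v))"
      using that by (simp add: T1 sum_distrib_left) (rule sum.swap)
    also have "\<dots> = (\<Sum>x\<in>V. W 1 u x * int (moore_bound 2 k))" by (simp add: rowM)
    also have "\<dots> = 2 * int (moore_bound 2 k)" using row that by (simp flip: sum_distrib_right)
    finally show ?thesis .
  qed
  define s where "s v = (if v \<in> S then 1 else 0 :: int)" for v
  have sum_s: "(\<Sum>v\<in>V. s v) = 4"
    using V(1) S unfolding s_def by (simp add: sum.If_cases Int_absorb1)
  have T: "T u v = 2 - s v" if u: "u \<in> V" and v: "v \<in> V" for u v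
  proof -
    \<comment> \<open>The order and the size of \<open>S\<close> match exactly: with
      \<open>m = moore_bound 2 k\<close>, the bounds sum to \<open>2 * (m + 2) - 4 = 2 * m\<close>,
      the row sum of \<open>T\<close>. Hence each bound is attained.\<close>
    have "(\<Sum>v\<in>V. 2 - s v - T u v) = 0"
      using V by (simp add: sum_subtractf sum_s rowT[OF u])
    moreover have "0 \<le> 2 - s v - T u v" if "v \<in> V" for v
      using T_le1[OF u] T_le2[OF u that] unfolding s_def by force
    ultimately have "2 - s v - T u v = 0"
      using V(1) v sum_nonneg_eq_0_iff[of V "\<lambda>v. 2 - s v - T u v"] by blast
    then show ?thesis by simp
  qed
  \<comment> \<open>The difference \<open>A ^ 2 M - A M\<close> telescopes.\<close>
  have "W (k + 2) u v - W 1 u v = (\<Sum>j\<le>k. W (Suc (Suc j)) u v) - T u v"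
    unfolding T_def by (induction k) simp_all
  also have "(\<Sum>j\<le>k. W (Suc (Suc j)) u v) = (\<Sum>j\<le>k. \<Sum>x\<in>V. W 1 u x * W (Suc j) x v)"
    by (intro sum.cong refl) (use add[OF uv, of 1] in simp)
  also have "\<dots> = (\<Sum>x\<in>V. W 1 u x * T x v)"
    unfolding T_def by (subst sum.swap) (simp add: sum_distrib_left)
  \<comment> \<open>The value \<open>T x v\<close> does not depend on \<open>x\<close>, so
    multiplying by \<open>A\<close> on the left only doubles it.\<close>
  also have "\<dots> = 2 * (2 - s v)" using T uv row by (simp flip: sum_distrib_right)
  finally show ?thesis using T[OF uv] by (simp add: s_def)
qed

section \<open>Counting walks in a finite digraph\<close>

definition (in pre_digraph) walk_count :: "nat \<Rightarrow> 'a \<Rightarrow> 'a \<Rightarrow> nat" where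
  "walk_count j u v = card {p. awalk u p v \<and> length p = j}"

context fin_digraph
begin

lemma finite_walks_of_length: "finite {p. awalk u p v \<and> length p = j}"
  by (rule finite_subset[OF _ finite_lists_length_eq[of "arcs G" j]]) auto

lemma walk_count_0: "u \<in> verts G \<Longrightarrow> walk_count 0 u v = (if u = v then 1 else 0)"
proof -
  assume "u \<in> verts G"
  then have "{p. awalk u p v \<and> length p = 0} = (if u = v then {[]} else {})"
    by (auto simp: awalk_Nil_iff)
  then show ?thesis unfolding walk_count_def by simp
qed

text \<open>Cut each walk after its first \<open>i\<close> arcs and sort the walks by the vertex
  reached there.\<close>

lemma walk_count_add:
  "walk_count (i + j) u v = (\<Sum>x\<in>verts G. walk_count i u x * walk_count j x v)"
proof -
  let ?W = "\<lambda>j u v. {p. awalk u p v \<and> length p = j}"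
  have "inj_on (\<lambda>(p, q). p @ q) (?W i u x \<times> ?W j x v)" for x
    by (auto simp: inj_on_def)
  then have card_x: "card ((\<lambda>(p, q). p @ q) ` (?W i u x \<times> ?W j x v))
      = walk_count i u x * walk_count j x v" for x
    by (simp add: card_image card_cartesian_product walk_count_def)
  have "?W (i + j) u v = (\<Union>x\<in>verts G. (\<lambda>(p, q). p @ q) ` (?W i u x \<times> ?W j x v))"
    (is "_ = ?R")
  proof (intro equalityI subsetI)
    fix r assume "r \<in> ?W (i + j) u v"
    then have r: "awalk u (take i r @ drop i r) v" "length r = i + j" by auto
    define x where "x = awlast u (take i r)"
    have x: "awalk u (take i r) x" "awalk x (drop i r) v"
      using r(1) unfolding awalk_append_iff x_def by auto
    have "(take i r, drop i r) \<in> ?W i u x \<times> ?W j x v" using x r(2) by auto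
    moreover have "x \<in> verts G" using x(1) by (rule awalk_last_in_verts)
    ultimately show "r \<in> ?R"
      by (intro UN_I[of x] image_eqI[of _ _ "(take i r, drop i r)"]) auto
  next
    fix r assume "r \<in> ?R"
    then show "r \<in> ?W (i + j) u v" by auto
  qed
  moreover have "card ?R = (\<Sum>x\<in>verts G. card ((\<lambda>(p, q). p @ q) ` (?W i u x \<times> ?W j x v)))"
  proof (rule card_UN_disjoint)
    show "\<forall>x\<in>verts G. finite ((\<lambda>(p, q). p @ q) ` (?W i u x \<times> ?W j x v))"
      by (intro ballI finite_imageI finite_cartesian_product finite_walks_of_length)
    \<comment> \<open>Both prefixes have length \<open>i\<close>, so equal concatenations have equal
      prefixes and hence the same cut vertex. This separates the classes.\<close>
    have end_eq: "x = y" if "p @ q = p' @ q'" "p \<in> ?W i u x" "p' \<in> ?W i u y" for x y p p' q q'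
    proof -
      have "p = p'" using that by (simp add: append_eq_append_conv)
      then have "awlast u p = x" "awlast u p = y" using that by auto
      then show ?thesis by simp
    qed
    show "\<forall>x\<in>verts G. \<forall>y\<in>verts G. x \<noteq> y \<longrightarrow>
        (\<lambda>(p, q). p @ q) ` (?W i u x \<times> ?W j x v) \<inter> (\<lambda>(p, q). p @ q) ` (?W i u y \<times> ?W j y v) = {}"
    proof (intro ballI impI Int_emptyI)
      fix x y r
      assume "x \<noteq> y" and rx: "r \<in> (\<lambda>(p, q). p @ q) ` (?W i u x \<times> ?W j x v)"
        and ry: "r \<in> (\<lambda>(p, q). p @ q) ` (?W i u y \<times> ?W j y v)"
      obtain p q where p: "r = p @ q" "p \<in> ?W i u x" using rx by (elim imageE) auto
      obtain p' q' where p': "r = p' @ q'" "p' \<in> ?W i u y" using ry by (elim imageE) auto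
      have "p @ q = p' @ q'" using p(1) p'(1) by (rule subst)
      then show False using end_eq[OF _ p(2) p'(2)] \<open>x \<noteq> y\<close> by blast
    qed
  qed simp
  ultimately show ?thesis by (simp add: walk_count_def[of "i + j"] card_x)
qed

lemma walk_count_1: "walk_count 1 u v = card {e \<in> arcs G. tail G e = u \<and> head G e = v}"
proof -
  have "{p. awalk u p v \<and> length p = 1} = (\<lambda>e. [e]) ` {e \<in> arcs G. tail G e = u \<and> head G e = v}"
    by (auto simp: length_Suc_conv awalk_Cons_iff awalk_Nil_iff)
  then show ?thesis unfolding walk_count_def by (simp add: card_image inj_on_def)
qed

lemma sum_walk_count_eq_out_degree: "(\<Sum>v\<in>verts G. walk_count 1 u v) = out_degree G u"
proof -
  have "card (\<Union>v\<in>verts G. {e \<in> arcs G. tail G e = u \<and> head G e = v})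
      = (\<Sum>v\<in>verts G. card {e \<in> arcs G. tail G e = u \<and> head G e = v})"
    by (rule card_UN_disjoint) auto
  moreover have "(\<Union>v\<in>verts G. {e \<in> arcs G. tail G e = u \<and> head G e = v}) = out_arcs G u"
    by auto
  ultimately show ?thesis by (simp add: walk_count_1 out_degree_def del: One_nat_def)
qed

lemma sum_walk_count_eq_in_degree: "(\<Sum>u\<in>verts G. walk_count 1 u v) = in_degree G v"
proof -
  have "card (\<Union>u\<in>verts G. {e \<in> arcs G. tail G e = u \<and> head G e = v})
      = (\<Sum>u\<in>verts G. card {e \<in> arcs G. tail G e = u \<and> head G e = v})"
    by (rule card_UN_disjoint) auto
  moreover have "(\<Union>u\<in>verts G. {e \<in> arcs G. tail G e = u \<and> head G e = v}) = in_arcs G v"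
    by auto
  ultimately show ?thesis by (simp add: walk_count_1 in_degree_def del: One_nat_def)
qed

lemma sum_in_degree_eq_sum_out_degree:
  "(\<Sum>v\<in>verts G. in_degree G v) = (\<Sum>u\<in>verts G. out_degree G u)"
  unfolding sum_walk_count_eq_in_degree[symmetric] sum_walk_count_eq_out_degree[symmetric]
  by (rule sum.swap)

text \<open>Walks of different lengths are different, so the sum counts all walks from
  \<open>u\<close> to \<open>v\<close> of length at most \<open>k\<close>.\<close>

lemma k_geodetic_sum_walk_count_le_1:
  assumes geo: "k_geodetic k G" and uv: "u \<in> verts G" "v \<in> verts G"
  shows "(\<Sum>j\<le>k. walk_count j u v) \<le> 1"
proof -
  have "(\<Sum>j\<le>k. walk_count j u v) = card (\<Union>j\<in>{..k}. {p. awalk u p v \<and> length p = j})"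
    unfolding walk_count_def by (rule card_UN_disjoint[symmetric]) (auto simp: finite_walks_of_length)
  also have "\<dots> \<le> Suc 0"
  proof (subst card_le_Suc0_iff_eq)
    show "finite (\<Union>j\<in>{..k}. {p. awalk u p v \<and> length p = j})"
      by (intro finite_UN_I finite_atMost finite_walks_of_length)
    show "\<forall>p\<in>\<Union>j\<in>{..k}. {p. awalk u p v \<and> length p = j}.
        \<forall>q\<in>\<Union>j\<in>{..k}. {p. awalk u p v \<and> length p = j}. p = q"
      using geo uv unfolding k_geodetic_def by simp
  qed
  finally show ?thesis by simp
qed

text \<open>The empty walk is already the unique short walk from \<open>u\<close> to itself. For
  \<open>j = 1\<close> and \<open>j = k\<close> this makes the two traces vanish.\<close>

lemma k_geodetic_closed_walk_count:
  assumes geo: "k_geodetic k G" and u: "u \<in> verts G" and j: "1 \<le> j" "j \<le> k"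
  shows "walk_count j u u = 0"
proof -
  have "p = []" if "awalk u p u" "length p = j" for p
    using geo u j that unfolding k_geodetic_def
    by (metis awalk_Nil_iff le0 list.size(3))
  then have "{p. awalk u p u \<and> length p = j} = {}" using j by fastforce
  then show ?thesis unfolding walk_count_def by (simp only: card.empty)
qed

end

section \<open>Degree sequence and adjacency matrix\<close>

lemma in_degree_sequence_mset:
  "mset (in_degree_sequence G) = image_mset (in_degree G) (mset_set (verts G))"
  by (simp add: in_degree_sequence_def)

lemma (in fin_digraph) card_in_degree_eq:
  "card {v \<in> verts G. in_degree G v = d} = count (mset (in_degree_sequence G)) d"
proof -
  have "{v. v \<in> verts G \<and> d = in_degree G v} = {v \<in> verts G. in_degree G v = d}"
    by auto
  then show ?thesis by (simp add: in_degree_sequence_mset count_image_mset')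
qed

lemma (in fin_digraph) sum_list_in_degree_sequence:
  "sum_list (in_degree_sequence G) = (\<Sum>v\<in>verts G. in_degree G v)"
  unfolding sum_mset_sum_list[symmetric] in_degree_sequence_mset sum_unfold_sum_mset ..

text \<open>The list \<open>vs\<close> numbers the vertices, which turns
  \<open>walk_count_add\<close> into matrix multiplication; distinctness of \<open>vs\<close> makes
  the zeroth power the identity.\<close>

lemma (in fin_digraph) mat_pow_walk_count:
  fixes vs :: "'a list"
  assumes vs: "set vs = verts G" "distinct vs" "length vs = n"
    and A: "A = mat n n (\<lambda>(i, j). of_nat (walk_count 1 (vs ! i) (vs ! j)))"
  shows "A ^\<^sub>m m = mat n n (\<lambda>(i, j). of_nat (walk_count m (vs ! i) (vs ! j)) :: 'c :: comm_ring_1)"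
proof (induction m)
  case 0
  show ?case
    using vs nth_mem[of _ vs]
    by (intro eq_matI) (auto simp: A walk_count_0 nth_eq_iff_index_eq simp del: nth_mem)
next
  case (Suc m)
  have reindex: "(\<Sum>x\<in>verts G. f x) = (\<Sum>l<n. f (vs ! l))" for f :: "'a \<Rightarrow> nat"
    using sum.reindex_bij_betw[OF bij_betw_nth[OF vs(2) refl refl], of f] vs by simp
  show ?case
    unfolding pow_mat.simps Suc
    using walk_count_add[of m 1]
    by (intro eq_matI) (simp_all add: A scalar_prod_def atLeast0LessThan reindex)
qed

section \<open>Contradiction from the degree data\<close>

theorem theorem10:
  fixes k :: nat
  assumes "2 \<le> k"
  shows "\<not> (\<exists>G :: ('a, 'b) pre_digraph.
           digraph G \<and> k_geodetic k G \<and>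
           2 \<le> min_out_degree G \<and>
           card (verts G) = moore_bound 2 k + 2 \<and>
           in_degree_sequence G =
             replicate 4 1 @ replicate (moore_bound 2 k + 2 - 8) 2 @ replicate 4 3)"
proof (rule notI, elim exE conjE)
  fix G :: "('a, 'b) pre_digraph"
  assume "digraph G" and geo: "k_geodetic k G" and min: "2 \<le> min_out_degree G"
    and card: "card (verts G) = moore_bound 2 k + 2"
    and seq: "in_degree_sequence G =
             replicate 4 1 @ replicate (moore_bound 2 k + 2 - 8) 2 @ replicate 4 3"
  interpret digraph G by fact
  define n where "n = card (verts G)"
  define S where "S = {v \<in> verts G. in_degree G v = 1}"
  \<comment> \<open>The left side is 7. The resulting \<open>8 \<le> n\<close> keeps the natural
    subtraction of 8 in the degree sequence from truncating, and later makes 0 a valid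
    index.\<close>
  have "(\<Sum>i\<le>2. 2 ^ i) \<le> moore_bound 2 k"
    unfolding moore_bound_def using assms by (intro sum_mono2) auto
  then have n8: "8 \<le> n" using card by (simp add: n_def numeral_2_eq_2)
  have out_ge: "2 \<le> out_degree G u" if "u \<in> verts G" for u
    using min that unfolding min_out_degree_def by (auto intro: order_trans Min_le)
  \<comment> \<open>The in-degrees sum to \<open>4 + 2 * (n - 8) + 12 = 2 * n\<close>, so the
    out-degrees average 2. Being at least 2, they all equal 2.\<close>
  have "(\<Sum>u\<in>verts G. out_degree G u) = sum_list (in_degree_sequence G)"
    by (simp add: sum_list_in_degree_sequence sum_in_degree_eq_sum_out_degree)
  also have "\<dots> = (\<Sum>u\<in>verts G. 2)"
    using n8 by (simp add: seq sum_list_replicate n_def card)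
  finally have out: "out_degree G u = 2" if "u \<in> verts G" for u
    using sum_mono_inv[of "\<lambda>_. 2" "verts G" "out_degree G" u] out_ge that by simp
  have "card S = 4"
    unfolding S_def card_in_degree_eq by (simp add: seq)
  have diff: "int (walk_count (k + 2) u v) - int (walk_count 1 u v) = 2 - (if v \<in> S then 1 else 0)"
    if "u \<in> verts G" "v \<in> verts G" for u v
  proof (rule walk_count_rank_one[where V = "verts G"])
    show "int (walk_count 0 u v) = (if u = v then 1 else 0)" if "u \<in> verts G" for u v
      using that by (simp add: walk_count_0)
    show "int (walk_count (i + j) u v) = (\<Sum>x\<in>verts G. int (walk_count i u x) * int (walk_count j x v))"
      for i j u v
      by (simp add: walk_count_add)
    show "(\<Sum>v\<in>verts G. int (walk_count 1 u v)) = 2" if "u \<in> verts G" for u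
      using sum_walk_count_eq_out_degree[of u] out[OF that] by (simp flip: of_nat_sum)
    show "(\<Sum>j\<le>k. int (walk_count j u v)) \<le> 1" if "u \<in> verts G" "v \<in> verts G" for u v
      using k_geodetic_sum_walk_count_le_1[OF geo that] by (simp flip: of_nat_sum)
    show "(\<Sum>u\<in>verts G. int (walk_count 1 u v)) = 1" if "v \<in> S" for v
      using sum_walk_count_eq_in_degree[of v] that by (simp add: S_def flip: of_nat_sum)
  qed (use card \<open>card S = 4\<close> that in \<open>auto simp: S_def\<close>)
  obtain vs where vs: "set vs = verts G" "distinct vs"
    using finite_distinct_list[OF finite_verts] by blast
  have len: "length vs = n" using distinct_card[OF vs(2)] vs(1) by (simp add: n_def)
  have vs_in: "vs ! i \<in> verts G" if "i < n" for i
    using that len nth_mem[of i vs] vs(1) by simp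
  define A :: "complex mat" where
    "A = mat n n (\<lambda>(i, j). of_nat (walk_count 1 (vs ! i) (vs ! j)))"
  note pow = mat_pow_walk_count[OF vs len A_def]
  \<comment> \<open>Natural values, each 1 or 2, let a vanishing sum be refuted by a single
    term.\<close>
  define w :: "nat \<Rightarrow> nat" where "w i = 2 - (if vs ! i \<in> S then 1 else 0)" for i
  have "(\<Sum>i<n. complex_of_nat (w i)) = 0"
  proof (rule no_rank_one_perturbation[OF _ assms])
    show "A \<in> carrier_mat n n" by (simp add: A_def)
    show "(\<Sum>j<n. A $$ (i, j)) = 2" if i: "i < n" for i
    proof -
      have "(\<Sum>j<n. walk_count 1 (vs ! i) (vs ! j)) = (\<Sum>v\<in>verts G. walk_count 1 (vs ! i) v)"
        by (rule sum.reindex_bij_betw, rule bij_betw_nth) (use vs len in auto)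
      also have "\<dots> = 2" using sum_walk_count_eq_out_degree out[OF vs_in[OF i]] by simp
      finally have "complex_of_nat (\<Sum>j<n. walk_count 1 (vs ! i) (vs ! j)) = of_nat 2"
        by (rule arg_cong)
      then show ?thesis using i by (simp add: A_def)
    qed
    show "(A ^\<^sub>m (k + 2)) $$ (i, j) - A $$ (i, j) = complex_of_nat (w j)"
      if "i < n" "j < n" for i j
    proof -
      have "int (walk_count (k + 2) (vs ! i) (vs ! j)) = int (walk_count 1 (vs ! i) (vs ! j) + w j)"
        using diff[OF vs_in[OF that(1)] vs_in[OF that(2)]] by (auto simp: w_def split: if_splits)
      then have "walk_count (k + 2) (vs ! i) (vs ! j) = walk_count 1 (vs ! i) (vs ! j) + w j"
        by (simp only: of_nat_eq_iff)
      then show ?thesis unfolding pow using that by (simp add: A_def)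
    qed
    show "(\<Sum>i<n. A $$ (i, i)) = 0"
      using assms k_geodetic_closed_walk_count[OF geo vs_in, of _ 1] by (simp add: A_def)
    show "(\<Sum>i<n. (A ^\<^sub>m k) $$ (i, i)) = 0"
      unfolding pow using assms k_geodetic_closed_walk_count[OF geo vs_in, of _ k] by simp
  qed
  then have "(\<Sum>i<n. w i) = 0" by (simp only: of_nat_eq_0_iff flip: of_nat_sum)
  then have "w 0 = 0" using n8 by simp
  then show False by (simp add: w_def split: if_splits)
qed

end
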